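(* Let $(\Omega,d)$ be a metric space, $Y$ a set, $h:Y\to[0,\infty)$ and $f:\Omega\times Y\to\mathbb{R}$. Let $\{x_k\}\subset\Omega$ and $\{y_k\}\subset Y$ be the sequences generated by the Inexact Restoration algorithm described in the context. Suppose that: (A1) at Step 1 of the algorithm, for all integers $k\ge0$ it is possible to compute, in finite time, $y^{\mathrm{re}}_k\in Y$ satisfying $h(y^{\mathrm{re}}_k)\le r\,h(y_k)$ and $f(x_k,y^{\mathrm{re}}_k)\le f(x_k,y_k)+\beta h(y_k)$; (A2) there exist $h_{\max}>0$ and $f_{\min}\in\mathbb{R}$ such that, for all $y\in Y$ and $x\in\Omega$, $h(y)\le h_{\max}$ and $f(x,y)\ge f_{\min}$. Then $$\lim_{k\to\infty}h(y_k)=0.$$ Moreover, if $\Omega$ is complete and $\nu\le1$, the sequence $\{x_k\}$ is convergent.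
   Context: Merit function: for $x\in\Omega$, $y\in Y$, $\theta\in(0,1)$, $\Phi(x,y,\theta)=\theta f(x,y)+(1-\theta)h(y)$. Algorithm. Parameters and starting data: $x_0\in\Omega$, $y_0\in Y$, $\theta_0\in(0,1)$, $\nu>0$, $r\in(0,1)$, $\alpha>0$, $\beta>0$. For $k=0,1,2,\dots$: Step 1 (restoration). Define $y^{\mathrm{re}}_k\in Y$ such that $h(y^{\mathrm{re}}_k)\le r\,h(y_k)$ and $f(x_k,y^{\mathrm{re}}_k)\le f(x_k,y_k)+\beta h(y_k)$. Step 2 (penalty parameter). If $\Phi(x_k,y^{\mathrm{re}}_k,\theta_k)\le\Phi(x_k,y_k,\theta_k)+\frac{1-r}{2}\left(h(y^{\mathrm{re}}_k)-h(y_k)\right)$, set $\theta_{k+1}=\theta_k$. Otherwise set $$\theta_{k+1}=\frac{(1+r)\left(h(y_k)-h(y^{\mathrm{re}}_k)\right)}{2\left(f(x_k,y^{\mathrm{re}}_k)-f(x_k,y_k)+h(y_k)-h(y^{\mathrm{re}}_k)\right)}.$$ Step 3 (optimization). Compute $y_{k+1}\in Y$ and $x_{k+1}\in\Omega$ such that $f(x_{k+1},y_{k+1})\le f(x_k,y^{\mathrm{re}}_k)-\alpha\, d(x_k,x_{k+1})^\nu$ and $\Phi(x_{k+1},y_{k+1},\theta_{k+1})\le\Phi(x_k,y_k,\theta_{k+1})+\frac{1-r}{2}\left(h(y^{\mathrm{re}}_k)-h(y_k)\right)$. Set $k\leftarrow k+1$ and go to Step 1. *)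

theory Defs
  imports "HOL-Analysis.Analysis"
begin

text \<open>The set \<open>Y\<close> and the metric space \<open>(\<Omega>, d)\<close> are carriers inside types; \<open>h\<close> and \<open>f\<close> are total
  functions of which only the values on \<open>Y\<close> and \<open>\<Omega> \<times> Y\<close> matter.\<close>

definition merit :: "('a \<Rightarrow> 'b \<Rightarrow> real) \<Rightarrow> ('b \<Rightarrow> real) \<Rightarrow> 'a \<Rightarrow> 'b \<Rightarrow> real \<Rightarrow> real" where
  "merit f h x y \<theta> = \<theta> * f x y + (1 - \<theta>) * h y"

definition restores ::
  "'b set \<Rightarrow> ('b \<Rightarrow> real) \<Rightarrow> ('a \<Rightarrow> 'b \<Rightarrow> real) \<Rightarrow> real \<Rightarrow> real \<Rightarrow> 'a \<Rightarrow> 'b \<Rightarrow> 'b \<Rightarrow> bool" where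
  "restores Y h f r \<beta> x y z \<longleftrightarrow>
     z \<in> Y \<and> h z \<le> r * h y \<and> f x z \<le> f x y + \<beta> * h y"

definition next_penalty ::
  "('b \<Rightarrow> real) \<Rightarrow> ('a \<Rightarrow> 'b \<Rightarrow> real) \<Rightarrow> real \<Rightarrow> 'a \<Rightarrow> 'b \<Rightarrow> 'b \<Rightarrow> real \<Rightarrow> real" where
  "next_penalty h f r x y z \<theta> =
     (if merit f h x z \<theta> \<le> merit f h x y \<theta> + (1 - r) / 2 * (h z - h y)
      then \<theta>
      else ((1 + r) * (h y - h z)) / (2 * (f x z - f x y + h y - h z)))"

text \<open>The choices in Steps 1 and 3 are not deterministic, so the algorithm is a relation on whole
  runs: \<open>x\<close>, \<open>y\<close> are the iterates, \<open>yre\<close> the restored points, \<open>\<theta>\<close> the penalty parameters. Since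
  \<open>\<nu> > 0\<close>, the library convention \<open>0 powr \<nu> = 0\<close> is the usual value.\<close>

definition inexact_restoration_run ::
  "'a set \<Rightarrow> ('a \<Rightarrow> 'a \<Rightarrow> real) \<Rightarrow> 'b set \<Rightarrow> ('b \<Rightarrow> real) \<Rightarrow> ('a \<Rightarrow> 'b \<Rightarrow> real)
    \<Rightarrow> real \<Rightarrow> real \<Rightarrow> real \<Rightarrow> real
    \<Rightarrow> (nat \<Rightarrow> 'a) \<Rightarrow> (nat \<Rightarrow> 'b) \<Rightarrow> (nat \<Rightarrow> 'b) \<Rightarrow> (nat \<Rightarrow> real) \<Rightarrow> bool" where
  "inexact_restoration_run \<Omega> d Y h f \<nu> r \<alpha> \<beta> x y yre \<theta> \<longleftrightarrow>
     x 0 \<in> \<Omega> \<and> y 0 \<in> Y \<and> 0 < \<theta> 0 \<and> \<theta> 0 < 1 \<and>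
     (\<forall>k. restores Y h f r \<beta> (x k) (y k) (yre k) \<and>
          \<theta> (Suc k) = next_penalty h f r (x k) (y k) (yre k) (\<theta> k) \<and>
          y (Suc k) \<in> Y \<and> x (Suc k) \<in> \<Omega> \<and>
          f (x (Suc k)) (y (Suc k)) \<le> f (x k) (yre k) - \<alpha> * d (x k) (x (Suc k)) powr \<nu> \<and>
          merit f h (x (Suc k)) (y (Suc k)) (\<theta> (Suc k))
            \<le> merit f h (x k) (y k) (\<theta> (Suc k)) + (1 - r) / 2 * (h (yre k) - h (y k)))"

end

theory Submission
  imports Defs
begin

text \<open>The penalty parameters are nonincreasing and bounded away from \<open>0\<close>, because Step 1 bounds the
  increase of \<open>f\<close> by a multiple of the decrease of \<open>h\<close>. Dividing the merit decrease by \<open>\<theta>\<close> and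
  writing \<open>\<rho> = (1 - \<theta>) / \<theta>\<close>, which is nondecreasing and bounded, the quantity
  \<open>f + \<rho> * (h - hmax)\<close> drops by at least a fixed multiple of \<open>h (y k)\<close> in every iteration. Being
  bounded below, it forces \<open>h (y k)\<close> to be summable. Then \<open>f (x k) (y k)\<close> drops by
  \<open>\<alpha> * d (x k) (x (Suc k)) powr \<nu>\<close> up to a summable error, so these powers are summable, and for
  \<open>\<nu> \<le> 1\<close> they eventually dominate the distances themselves.\<close>

text \<open>Telescoping the descent bounds the partial sums of \<open>a\<close> by
  \<open>W 0 - m + suminf b\<close>. It serves twice: without error for the values of
  \<open>h\<close>, then with an error proportional to \<open>h\<close> for the powers of the
  distances.\<close>

lemma summable_of_descent:
  fixes W a b :: "nat \<Rightarrow> real"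
  assumes step: "\<And>k. W (Suc k) \<le> W k - a k + b k"
    and a: "\<And>k. 0 \<le> a k" and b: "\<And>k. 0 \<le> b k" "summable b"
    and W: "\<And>k. m \<le> W k"
  shows "summable a"
proof (rule summableI_nonneg_bounded)
  fix n
  have "(\<Sum>k<n. a k) \<le> W 0 - W n + (\<Sum>k<n. b k)"
  proof (induction n)
    case (Suc n)
    then show ?case using step[of n] by simp
  qed simp
  moreover have "(\<Sum>k<n. b k) \<le> suminf b"
    using b by (intro sum_le_suminf) auto
  ultimately show "(\<Sum>k<n. a k) \<le> W 0 - m + suminf b"
    using W[of n] by linarith
qed (rule a)

text \<open>Iterating the triangle inequality bounds \<open>d (x m) (x n)\<close> by a block of a
  convergent series.\<close>

lemma (in Metric_space) MCauchy_if_summable_steps: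
  assumes x: "range x \<subseteq> M" and sm: "summable (\<lambda>k. d (x k) (x (Suc k)))"
  shows "MCauchy x"
proof -
  have chain: "d (x m) (x n) \<le> (\<Sum>k=m..<n. d (x k) (x (Suc k)))" if "m \<le> n" for m n
    using that
  proof (induction n rule: dec_induct)
    case base
    then show ?case using x by (simp add: range_subsetD)
  next
    case (step n)
    have "d (x m) (x (Suc n)) \<le> d (x m) (x n) + d (x n) (x (Suc n))"
      using x by (intro triangle) auto
    then show ?case using step by simp
  qed
  have "\<exists>N. \<forall>m n. N \<le> m \<longrightarrow> N \<le> n \<longrightarrow> d (x m) (x n) < e" if "0 < e" for e
  proof -
    obtain N where N: "\<And>m n. N \<le> m \<Longrightarrow> \<bar>\<Sum>k=m..<n. d (x k) (x (Suc k))\<bar> < e"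
      using sm \<open>0 < e\<close> unfolding summable_Cauchy real_norm_def by blast
    have "d (x m) (x n) < e" if "N \<le> m" "m \<le> n" for m n
      using chain[OF \<open>m \<le> n\<close>] N[OF \<open>N \<le> m\<close>, of n] by linarith
    then show ?thesis
      by (metis commute nat_le_linear)
  qed
  then show ?thesis
    unfolding MCauchy_def using x by blast
qed

text \<open>A reset occurs only when the test fails, and that failure, solved for \<theta>, says
  that the new value is smaller. The lower bound on a reset value does not involve \<theta>, so
  repeated resets cannot drive the parameters to 0.\<close>

lemma next_penalty_bounds:
  fixes \<theta> :: real
  assumes r: "0 < r" "r < 1" and \<beta>: "0 < \<beta>" and \<theta>: "0 < \<theta>"
    and h: "0 \<le> h y" and re: "restores Y h f r \<beta> x y z"
  defines "\<theta>' \<equiv> next_penalty h f r x y z \<theta>"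
  shows "\<theta>' \<le> \<theta>" and "min \<theta> ((1 + r) / (2 * (\<beta> / (1 - r) + 1))) \<le> \<theta>'"
proof -
  define a where "a = h y - h z"
  define \<delta> where "\<delta> = f x z - f x y"
  have ah: "(1 - r) * h y \<le> a" and \<delta>h: "\<delta> \<le> \<beta> * h y"
    using re by (auto simp: restores_def a_def \<delta>_def algebra_simps)
  have a0: "0 \<le> a"
    using ah h r by (smt (verit) mult_nonneg_nonneg)
  have "h y \<le> a / (1 - r)"
    using ah r by (simp add: pos_le_divide_eq mult.commute)
  then have \<delta>a: "\<delta> \<le> \<beta> * (a / (1 - r))"
    using \<delta>h \<beta> by (smt (verit) mult_left_mono)
  \<comment> \<open>The threshold is linear in \<theta>, and the reset formula is the value of
    \<theta> that gives equality.\<close>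
  have test: "merit f h x z \<theta> \<le> merit f h x y \<theta> + (1 - r) / 2 * (h z - h y)
      \<longleftrightarrow> \<theta> * (\<delta> + a) \<le> (1 + r) / 2 * a"
    by (simp add: merit_def a_def \<delta>_def field_simps)
  have eq: "\<theta>' = (if \<theta> * (\<delta> + a) \<le> (1 + r) / 2 * a then \<theta> else (1 + r) * a / (2 * (\<delta> + a)))"
    unfolding \<theta>'_def next_penalty_def test by (simp add: a_def \<delta>_def algebra_simps)
  have "\<theta>' \<le> \<theta> \<and> min \<theta> ((1 + r) / (2 * (\<beta> / (1 - r) + 1))) \<le> \<theta>'"
  proof (cases "\<theta> * (\<delta> + a) \<le> (1 + r) / 2 * a")
    case False
    have "0 \<le> (1 + r) / 2 * a" using a0 r by simp
    then have "0 < \<theta> * (\<delta> + a)" using False by linarith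
    then have pos: "0 < \<delta> + a" using \<theta> by (simp add: zero_less_mult_iff)
    \<comment> \<open>Step 1 gives \<delta> \<le> \<beta> * \<open>h y\<close> and
      \<open>h y\<close> \<le> \<open>a / (1 - r)\<close>; adding \<open>a\<close> turns this into
      the factor \<open>K\<close>.\<close>
    define K where "K = \<beta> / (1 - r) + 1"
    have le: "\<delta> + a \<le> a * K"
      using \<delta>a by (simp add: K_def algebra_simps)
    have K: "0 < K" using \<beta> r by (simp add: K_def add_pos_pos)
    have upper: "(1 + r) * a / (2 * (\<delta> + a)) \<le> \<theta>"
      using False pos by (simp add: pos_divide_le_eq algebra_simps)
    have "(1 + r) * (\<delta> + a) \<le> (1 + r) * (a * K)"
      using le r by (intro mult_left_mono) auto
    then have "(1 + r) / (2 * K) \<le> (1 + r) * a / (2 * (\<delta> + a))"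
      using K pos by (simp add: divide_simps) (simp add: algebra_simps)
    then have "(1 + r) / (2 * (\<beta> / (1 - r) + 1)) \<le> (1 + r) * a / (2 * (\<delta> + a))"
      unfolding K_def .
    then show ?thesis using upper False by (simp add: eq)
  qed (simp add: eq)
  then show "\<theta>' \<le> \<theta>" and "min \<theta> ((1 + r) / (2 * (\<beta> / (1 - r) + 1))) \<le> \<theta>'"
    by auto
qed

theorem theorem3p3:
  fixes \<Omega> :: "'a set" and d :: "'a \<Rightarrow> 'a \<Rightarrow> real" and Y :: "'b set"
    and h :: "'b \<Rightarrow> real" and f :: "'a \<Rightarrow> 'b \<Rightarrow> real"
    and \<nu> r \<alpha> \<beta> :: real
    and x :: "nat \<Rightarrow> 'a" and y yre :: "nat \<Rightarrow> 'b" and \<theta> :: "nat \<Rightarrow> real"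
  assumes metric: "Metric_space \<Omega> d"
    and h_nonneg: "\<forall>u\<in>Y. 0 \<le> h u"
    and params: "0 < \<nu>" "0 < r" "r < 1" "0 < \<alpha>" "0 < \<beta>"
    and run: "inexact_restoration_run \<Omega> d Y h f \<nu> r \<alpha> \<beta> x y yre \<theta>"
    and A1: "\<forall>k. \<exists>z. restores Y h f r \<beta> (x k) (y k) z"
    and A2: "\<exists>hmax>0. \<exists>fmin::real. \<forall>v\<in>Y. \<forall>u\<in>\<Omega>. h v \<le> hmax \<and> fmin \<le> f u v"
  shows "(\<lambda>k. h (y k)) \<longlonglongrightarrow> 0 \<and>
         (Metric_space.mcomplete \<Omega> d \<and> \<nu> \<le> 1 \<longrightarrow>
            (\<exists>l\<in>\<Omega>. limitin (Metric_space.mtopology \<Omega> d) x l sequentially))"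
proof -
  interpret Metric_space \<Omega> d by (rule metric)
  obtain hmax fmin where bnd: "\<And>u v. v \<in> Y \<Longrightarrow> u \<in> \<Omega> \<Longrightarrow> h v \<le> hmax \<and> fmin \<le> f u v"
    using A2 by blast
  note run' = run[unfolded inexact_restoration_run_def]
  have x_in: "x k \<in> \<Omega>" and y_in: "y k \<in> Y" for k
    using run' by (cases k; blast)+
  have re: "restores Y h f r \<beta> (x k) (y k) (yre k)"
    and \<theta>_Suc: "\<theta> (Suc k) = next_penalty h f r (x k) (y k) (yre k) (\<theta> k)"
    and f_Suc: "f (x (Suc k)) (y (Suc k)) \<le> f (x k) (yre k) - \<alpha> * d (x k) (x (Suc k)) powr \<nu>"
    and merit_Suc: "merit f h (x (Suc k)) (y (Suc k)) (\<theta> (Suc k))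
      \<le> merit f h (x k) (y k) (\<theta> (Suc k)) + (1 - r) / 2 * (h (yre k) - h (y k))" for k
    using run' by blast+
  have \<theta>0: "0 < \<theta> 0" "\<theta> 0 < 1" using run' by blast+
  have h0: "0 \<le> h (y k)" and hmax: "h (y k) \<le> hmax" for k
    using h_nonneg y_in bnd x_in by blast+
  have fmin: "fmin \<le> f (x k) (y k)" for k
    using bnd x_in y_in by blast

  \<comment> \<open>The starting value or the bound on reset values, whichever is smaller; each
    update preserves it as a lower bound.\<close>
  define \<theta>min where "\<theta>min = min (\<theta> 0) ((1 + r) / (2 * (\<beta> / (1 - r) + 1)))"
  have \<theta>min: "0 < \<theta>min"
    using \<theta>0 params by (simp add: \<theta>min_def add_pos_pos)
  have \<theta>_bounds: "\<theta>min \<le> \<theta> k \<and> \<theta> k < 1" for k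
  proof (induction k)
    case 0
    then show ?case using \<theta>0 by (simp add: \<theta>min_def)
  next
    case (Suc k)
    then have "0 < \<theta> k" using \<theta>min by linarith
    note next_penalty_bounds[OF params(2,3,5) this h0 re, of k]
    then show ?case using Suc by (auto simp only: \<theta>_Suc \<theta>min_def)
  qed
  have \<theta>_pos: "0 < \<theta> k" for k using \<theta>_bounds[of k] \<theta>min by linarith
  have \<theta>_mono: "\<theta> (Suc k) \<le> \<theta> k" for k
    using next_penalty_bounds(1)[OF params(2,3,5) \<theta>_pos h0 re] by (simp add: \<theta>_Suc)

  define \<rho> where "\<rho> k = 1 / \<theta> k - 1" for k
  have \<rho>_mono: "\<rho> k \<le> \<rho> (Suc k)" for k
    using \<theta>_mono \<theta>_pos by (simp add: \<rho>_def frac_le)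
  have \<rho>_bounds: "0 \<le> \<rho> k" "\<rho> k \<le> 1 / \<theta>min" for k
  proof -
    show "0 \<le> \<rho> k" using \<theta>_bounds[of k] \<theta>_pos[of k] by (simp add: \<rho>_def)
    have "1 / \<theta> k \<le> 1 / \<theta>min"
      using \<theta>_bounds[of k] \<theta>min by (intro frac_le) auto
    then show "\<rho> k \<le> 1 / \<theta>min" by (simp add: \<rho>_def)
  qed
  have merit_div: "merit f h u v (\<theta> k) / \<theta> k = f u v + \<rho> k * h v" for u v k
    using \<theta>_pos[of k] by (simp add: merit_def \<rho>_def field_simps)

  \<comment> \<open>One factor \<open>(1 - r) / 2\<close> comes from the merit decrease in Step 3,
    the other \<open>1 - r\<close> from the restoration of \<open>h\<close> in Step 1.\<close>
  define c where "c = (1 - r) / 2 * (1 - r)"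
  have c: "0 < c" using params by (simp add: c_def)
  \<comment> \<open>Subtracting \<open>hmax\<close> makes the factor of \<rho> nonpositive, so the
    growth of \<rho> can only lower \<open>W\<close>.\<close>
  define W where "W k = f (x k) (y k) + \<rho> k * (h (y k) - hmax)" for k
  have W_Suc: "W (Suc k) \<le> W k - c * h (y k)" for k
  proof -
    have "(1 - r) / 2 * (h (yre k) - h (y k)) \<le> (1 - r) / 2 * (- ((1 - r) * h (y k)))"
      using re[of k] params by (intro mult_left_mono) (auto simp: restores_def algebra_simps)
    also have "\<dots> = - (c * h (y k))" by (simp add: c_def)
    finally have "merit f h (x (Suc k)) (y (Suc k)) (\<theta> (Suc k))
        \<le> merit f h (x k) (y k) (\<theta> (Suc k)) - c * h (y k)"
      using merit_Suc[of k] by linarith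
    then have "merit f h (x (Suc k)) (y (Suc k)) (\<theta> (Suc k)) / \<theta> (Suc k)
        \<le> (merit f h (x k) (y k) (\<theta> (Suc k)) - c * h (y k)) / \<theta> (Suc k)"
      using \<theta>_pos[of "Suc k"] by (intro divide_right_mono) auto
    then have "f (x (Suc k)) (y (Suc k)) + \<rho> (Suc k) * h (y (Suc k))
        \<le> f (x k) (y k) + \<rho> (Suc k) * h (y k) - c * h (y k) / \<theta> (Suc k)"
      by (simp add: diff_divide_distrib merit_div)
    \<comment> \<open>As \<theta> is below 1, the division only enlarges the decrease.\<close>
    moreover have "c * h (y k) \<le> c * h (y k) / \<theta> (Suc k)"
      using \<theta>_bounds[of "Suc k"] \<theta>_pos[of "Suc k"] c h0[of k]
      by (simp add: pos_le_divide_eq mult_left_le)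
    moreover have "0 \<le> (\<rho> (Suc k) - \<rho> k) * (hmax - h (y k))"
      using \<rho>_mono[of k] hmax[of k] by simp
    ultimately show ?thesis
      by (simp add: W_def algebra_simps)
  qed
  have W_min: "fmin - 1 / \<theta>min * hmax \<le> W k" for k
  proof -
    have "\<rho> k * (hmax - h (y k)) \<le> 1 / \<theta>min * hmax"
      using \<rho>_bounds[of k] hmax[of k] h0[of k] \<theta>min by (intro mult_mono) auto
    then show ?thesis
      using fmin[of k] by (simp add: W_def algebra_simps)
  qed
  have "summable (\<lambda>k. c * h (y k))"
    by (rule summable_of_descent[where W = W and b = "\<lambda>_. 0"])
      (use W_Suc W_min c h0 in auto)
  then have h_sum: "summable (\<lambda>k. h (y k))"
    using c by (simp add: summable_cmult_iff)

  have "summable (\<lambda>k. \<alpha> * d (x k) (x (Suc k)) powr \<nu>)"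
  \<comment> \<open>Here the descending quantity is \<open>f (x k) (y k)\<close> itself: Step 1 may
    raise it by \<beta> * \<open>h (y k)\<close>, before Step 3 lowers it.\<close>
  proof (rule summable_of_descent[where b = "\<lambda>k. \<beta> * h (y k)"])
    show "f (x (Suc k)) (y (Suc k))
        \<le> f (x k) (y k) - \<alpha> * d (x k) (x (Suc k)) powr \<nu> + \<beta> * h (y k)" for k
      using f_Suc[of k] re[of k] by (simp add: restores_def)
  qed (use params h0 h_sum fmin in \<open>auto intro: summable_mult\<close>)
  then have d_sum: "summable (\<lambda>k. d (x k) (x (Suc k)) powr \<nu>)"
    using params by (simp add: summable_cmult_iff)

  have "\<exists>l\<in>\<Omega>. limitin mtopology x l sequentially" if "mcomplete" "\<nu> \<le> 1"
  proof -
    have "\<forall>\<^sub>F k in sequentially. d (x k) (x (Suc k)) powr \<nu> < 1"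
      using summable_LIMSEQ_zero[OF d_sum] by (rule order_tendstoD) simp
    then have "\<forall>\<^sub>F k in sequentially. norm (d (x k) (x (Suc k))) \<le> d (x k) (x (Suc k)) powr \<nu>"
    proof eventually_elim
      case (elim k)
      \<comment> \<open>A base of at least 1 would have a power of at least 1. On [0, 1], lowering
        the exponent from 1 to \<nu> can only increase the power.\<close>
      have "d (x k) (x (Suc k)) \<le> 1"
        using elim params(1) ge_one_powr_ge_zero[of "d (x k) (x (Suc k))" \<nu>] by linarith
      then have "d (x k) (x (Suc k)) powr 1 \<le> d (x k) (x (Suc k)) powr \<nu>"
        using \<open>\<nu> \<le> 1\<close> by (intro powr_mono') auto
      then show ?case by simp
    qed
    then have "summable (\<lambda>k. d (x k) (x (Suc k)))"
      using d_sum by (rule summable_comparison_test_ev)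
    then have "MCauchy x"
      using x_in by (intro MCauchy_if_summable_steps) auto
    then obtain l where "limitin mtopology x l sequentially"
      using \<open>mcomplete\<close> unfolding mcomplete_def by blast
    then show ?thesis
      using limitin_mspace by blast
  qed
  then show ?thesis
    using summable_LIMSEQ_zero[OF h_sum] by blast
qed

end
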